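(* Let $\ell, m$ be positive integers with $\ell \leq m$, let $H = K_{\ell,m}$ and let $R = R(H,H)$. Then for every integer $k \geq 2$, $$R + (\ell-1)(k-2) \leq gr_k(K_3 : H) \leq (R + k - 3)(\ell - 1) + 1.$$
   Context: $K_{\ell,m}$ is the complete bipartite graph with parts of sizes $\ell$ and $m$. $R(H,H)$ is the least $n$ such that every red/blue coloring of the edges of $K_n$ contains a monochromatic copy of $H$. A rainbow triangle is a triangle whose three edges have three distinct colors. $gr_k(K_3 : H)$ is the minimum integer $n$ such that every $k$-coloring of the edges of $K_n$ (using all $k$ colors) contains either a rainbow triangle or a monochromatic copy of $H$.
   Formalization: Proved for ℓ ≥ 2: at ℓ = 1 the bounds would give R ≤ 1, but R ≥ 2. Also gr_k(K_3:H) is read as the least n such that every K_N with N ≥ n has the property, since the literal minimum is attained vacuously at tiny n, where no coloring uses all k colors. *)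

theory Defs
  imports Main
begin

text \<open>
  A simple graph is a pair of a vertex set and a set of two-element subsets of it.
\<close>

type_synonym 'a ugraph = "'a set \<times> 'a set set"

abbreviation verts :: "'a ugraph \<Rightarrow> 'a set" where
  "verts \<equiv> fst"

abbreviation edges :: "'a ugraph \<Rightarrow> 'a set set" where
  "edges \<equiv> snd"

definition complete_graph :: "nat \<Rightarrow> nat ugraph" where
  "complete_graph n = ({..<n}, {e. e \<subseteq> {..<n} \<and> card e = 2})"

definition complete_bipartite :: "nat \<Rightarrow> nat \<Rightarrow> (nat + nat) ugraph" where
  "complete_bipartite l m =
     ({..<l} <+> {..<m}, {{Inl i, Inr j} | i j. i < l \<and> j < m})"

text \<open>
  An edge colouring is a total function on sets of vertices; its values outside the
  edge set of the coloured graph are never inspected. Copies are as subgraphs,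
  not necessarily induced.
\<close>

definition is_copy :: "('a \<Rightarrow> 'b) \<Rightarrow> 'a ugraph \<Rightarrow> 'b ugraph \<Rightarrow> bool" where
  "is_copy f H G \<longleftrightarrow>
     inj_on f (verts H) \<and> f ` verts H \<subseteq> verts G \<and> (\<forall>e\<in>edges H. f ` e \<in> edges G)"

definition has_mono_copy :: "'a ugraph \<Rightarrow> 'b ugraph \<Rightarrow> ('b set \<Rightarrow> nat) \<Rightarrow> bool" where
  "has_mono_copy H G c \<longleftrightarrow>
     (\<exists>f i. is_copy f H G \<and> (\<forall>e\<in>edges H. c (f ` e) = i))"

definition has_rainbow_triangle :: "'b ugraph \<Rightarrow> ('b set \<Rightarrow> nat) \<Rightarrow> bool" where
  "has_rainbow_triangle G c \<longleftrightarrow>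
     (\<exists>x y z. {x, y} \<in> edges G \<and> {y, z} \<in> edges G \<and> {x, z} \<in> edges G \<and>
        x \<noteq> y \<and> y \<noteq> z \<and> x \<noteq> z \<and>
        c {x, y} \<noteq> c {y, z} \<and> c {y, z} \<noteq> c {x, z} \<and> c {x, y} \<noteq> c {x, z})"

text \<open>The Ramsey number $R(H,H)$; colours 0 and 1 are red and blue.\<close>

definition ramsey_number :: "'a ugraph \<Rightarrow> nat" where
  "ramsey_number H =
     (LEAST n. \<forall>c. c ` edges (complete_graph n) \<subseteq> {0, 1} \<longrightarrow>
        has_mono_copy H (complete_graph n) c)"

text \<open>
  The Gallai-Ramsey number $gr_k(K_3 : H)$. Colourings use all $k$ colours. The property
  is required of every order $N \ge n$, not only of $n$: it is not monotone in the order,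
  and for small orders it holds vacuously, because there are not enough edges for $k$
  colours (or only enough for colourings with a rainbow triangle).
\<close>

definition gallai_ramsey :: "nat \<Rightarrow> 'a ugraph \<Rightarrow> nat" where
  "gallai_ramsey k H =
     (LEAST n. \<forall>N\<ge>n. \<forall>c. c ` edges (complete_graph N) = {..<k} \<longrightarrow>
        has_rainbow_triangle (complete_graph N) c \<or> has_mono_copy H (complete_graph N) c)"

end

theory Submission
  imports Defs "HOL-Library.Ramsey"
begin

text \<open>
  Lower bound: extend an extremal 2-colouring of \<open>K\<^bsub>R-1\<^esub>\<close> by \<open>l - 1\<close> new vertices for every
  further colour, which is given to all edges from them to themselves and to earlier vertices.

  Upper bound: let \<open>A\<close> be a smallest set of at least \<open>m\<close> vertices that every outside vertex sees
  in a single colour. At most \<open>l - 1\<close> outside vertices see \<open>A\<close> in a given colour. Take a Gallai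
  partition of \<open>A\<close>, with red and blue between the parts, and let \<open>W\<close> be \<open>A\<close> together with the outside
  vertices that see it in red or blue; it has to be shown that \<open>|W| \<le> (R - 1)(l - 1)\<close>. The parts
  of \<open>A\<close> and the two sets added to it partition \<open>W\<close> with only red and blue in between. If all
  these classes have at most \<open>l - 1\<close> vertices, then their number is at most \<open>R - 1\<close>, because
  representatives form a 2-coloured complete graph. Otherwise some part of \<open>A\<close> has between \<open>l\<close> and
  \<open>m - 1\<close> vertices (by minimality of \<open>A\<close>), at most \<open>m - 1\<close> vertices of \<open>W\<close> see it in red and as
  many in blue, and so \<open>|W| \<le> 3(m - 1)\<close>. For \<open>l \<ge> 3\<close> the bound \<open>R > 2(m - 1)\<close> then suffices. For
  \<open>l = 2\<close> one needs \<open>R > 3(m - 1)\<close>, which is proved by explicit 2-colourings with small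
  codegrees in both colours.
\<close>

section \<open>Monochromatic copies of K_{l,m} as pairs of vertex sets\<close>

text \<open>The vertex set is arbitrary, so that the notion passes to subsets and along bijections.
  Disjointness of the sides ensures that \<open>c\<close> is read on genuine edges only.\<close>

definition mono_bip :: "nat \<Rightarrow> nat \<Rightarrow> 'a set \<Rightarrow> ('a set \<Rightarrow> nat) \<Rightarrow> bool" where
  "mono_bip l m V c \<longleftrightarrow>
     (\<exists>X Y i. X \<subseteq> V \<and> Y \<subseteq> V \<and> X \<inter> Y = {} \<and> card X = l \<and> card Y = m \<and>
        (\<forall>x\<in>X. \<forall>y\<in>Y. c {x, y} = i))"

lemma mono_bipI:
  assumes "X \<subseteq> V" "Y \<subseteq> V" "X \<inter> Y = {}" "card X = l" "card Y = m"
    and "\<And>x y. x \<in> X \<Longrightarrow> y \<in> Y \<Longrightarrow> c {x, y} = i"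
  shows "mono_bip l m V c"
  unfolding mono_bip_def
  by (rule exI[of _ X], rule exI[of _ Y], rule exI[of _ i]) (simp add: assms)

lemma mono_bipE:
  assumes "mono_bip l m V c"
  obtains X Y i where "X \<subseteq> V" "Y \<subseteq> V" "X \<inter> Y = {}" "card X = l" "card Y = m"
    and "\<forall>x\<in>X. \<forall>y\<in>Y. c {x, y} = i"
  using assms unfolding mono_bip_def by blast

lemma mono_bip_leI:
  assumes "X \<subseteq> V" "Y \<subseteq> V" "X \<inter> Y = {}" "l \<le> card X" "m \<le> card Y"
    and "\<And>x y. x \<in> X \<Longrightarrow> y \<in> Y \<Longrightarrow> c {x, y} = i"
  shows "mono_bip l m V c"
proof -
  obtain X' where X': "X' \<subseteq> X" "card X' = l" using assms(4) by (meson obtain_subset_with_card_n)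
  obtain Y' where Y': "Y' \<subseteq> Y" "card Y' = m" using assms(5) by (meson obtain_subset_with_card_n)
  show ?thesis
    by (rule mono_bipI[of X' V Y' l m c i]) (use X' Y' assms in blast)+
qed

lemma mono_bip_mono:
  assumes "mono_bip l m V c" "V \<subseteq> W"
  shows "mono_bip l m W c"
proof -
  from assms(1) obtain X Y i where "X \<subseteq> V" "Y \<subseteq> V" "X \<inter> Y = {}" "card X = l" "card Y = m"
    and "\<forall>x\<in>X. \<forall>y\<in>Y. c {x, y} = i" by (rule mono_bipE)
  then show ?thesis
    using assms(2) by (intro mono_bipI[of X W Y l m c i]) auto
qed

lemma mono_bip_commute:
  assumes "mono_bip l m V c"
  shows "mono_bip m l V c"
proof -
  from assms obtain X Y i where XY: "X \<subseteq> V" "Y \<subseteq> V" "X \<inter> Y = {}" "card X = l" "card Y = m"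
    and i [rule_format]: "\<forall>x\<in>X. \<forall>y\<in>Y. c {x, y} = i" by (rule mono_bipE)
  have "c {y, x} = i" if "y \<in> Y" "x \<in> X" for x y
    using i[OF that(2,1)] by (simp add: insert_commute)
  then show ?thesis
    using XY by (intro mono_bipI[of Y V X m l c i]) (auto simp: Int_commute)
qed

text \<open>The sides are the images of the two summands under the embedding; conversely,
  enumerations of the sides are glued to an embedding by \<open>case_sum\<close>.\<close>

lemma has_mono_copy_complete_bipartite_iff:
  "has_mono_copy (complete_bipartite l m) (complete_graph n) c \<longleftrightarrow> mono_bip l m {..<n} c"
proof
  assume "has_mono_copy (complete_bipartite l m) (complete_graph n) c"
  then obtain f i where f: "is_copy f (complete_bipartite l m) (complete_graph n)"
    and i: "\<And>e. e \<in> edges (complete_bipartite l m) \<Longrightarrow> c (f ` e) = i"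
    unfolding has_mono_copy_def by blast
  have inj: "inj_on f ({..<l} <+> {..<m})" and sub: "f ` ({..<l} <+> {..<m}) \<subseteq> {..<n}"
    using f by (auto simp: is_copy_def complete_bipartite_def complete_graph_def)
  let ?X = "f ` Inl ` {..<l}" and ?Y = "f ` Inr ` {..<m}"
  have XY: "Inl ` {..<l} \<subseteq> {..<l} <+> {..<m}" "Inr ` {..<m} \<subseteq> {..<l} <+> {..<m}" by auto
  have "card ?X = l"
    using card_image[OF inj_on_subset[OF inj XY(1)]] by (simp add: card_image)
  moreover have "card ?Y = m"
    using card_image[OF inj_on_subset[OF inj XY(2)]] by (simp add: card_image)
  moreover have "?X \<inter> ?Y = {}"
    using inj_on_image_Int[OF inj XY] by auto
  moreover have "c {f (Inl a), f (Inr b)} = i" if "a < l" "b < m" for a b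
  proof -
    have "{Inl a, Inr b} \<in> edges (complete_bipartite l m)"
      using that by (auto simp: complete_bipartite_def)
    from i[OF this] show ?thesis by simp
  qed
  ultimately show "mono_bip l m {..<n} c"
    using order.trans[OF image_mono[OF XY(1)] sub] order.trans[OF image_mono[OF XY(2)] sub]
    by (intro mono_bipI[of ?X _ ?Y _ _ _ i]) auto
next
  assume "mono_bip l m {..<n} c"
  then obtain X Y i where XY: "X \<subseteq> {..<n}" "Y \<subseteq> {..<n}" "X \<inter> Y = {}" "card X = l" "card Y = m"
    and i [rule_format]: "\<forall>x\<in>X. \<forall>y\<in>Y. c {x, y} = i" by (rule mono_bipE)
  have "finite X" "finite Y" using XY finite_subset by blast+
  then obtain g h where g: "bij_betw g {..<l} X" and h: "bij_betw h {..<m} Y"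
    using ex_bij_betw_nat_finite[of X] ex_bij_betw_nat_finite[of Y] XY(4,5) by (auto simp: atLeast0LessThan)
  let ?f = "case_sum g h"
  have gX: "g a \<in> X" if "a < l" for a using g that by (auto simp: bij_betw_def)
  have hY: "h a \<in> Y" if "a < m" for a using h that by (auto simp: bij_betw_def)
  have gh: "g a \<noteq> h b" if "a < l" "b < m" for a b using gX[OF that(1)] hY[OF that(2)] XY(3) by auto
  have "inj_on g {..<l}" "inj_on h {..<m}" using g h by (auto simp: bij_betw_def)
  then have "inj_on ?f ({..<l} <+> {..<m})"
    using gh gh[symmetric] unfolding inj_on_def by (simp add: ball_Un Plus_def)
  moreover have "?f ` ({..<l} <+> {..<m}) \<subseteq> {..<n}"
    using gX hY XY(1,2) by (auto simp: subset_iff)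
  moreover have "card {g a, h b} = 2 \<and> {g a, h b} \<subseteq> {..<n}" if "a < l" "b < m" for a b
    using gh[OF that] gX[OF that(1)] hY[OF that(2)] XY(1,2) by (simp add: subset_iff)
  ultimately have "is_copy ?f (complete_bipartite l m) (complete_graph n)"
    by (auto simp: is_copy_def complete_bipartite_def complete_graph_def)
  moreover have "\<forall>e\<in>edges (complete_bipartite l m). c (?f ` e) = i"
    using i gX hY by (auto simp: complete_bipartite_def)
  ultimately show "has_mono_copy (complete_bipartite l m) (complete_graph n) c"
    unfolding has_mono_copy_def by blast
qed

lemma edges_complete_graph: "edges (complete_graph n) = {{x, y} |x y. x < n \<and> y < n \<and> x \<noteq> y}"
  by (auto simp: complete_graph_def card_2_iff)

subsection \<open>Gallai partitions\<close>

definition rainbow_free :: "'a set \<Rightarrow> ('a set \<Rightarrow> 'c) \<Rightarrow> bool" where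
  "rainbow_free V c \<longleftrightarrow>
     (\<forall>x\<in>V. \<forall>y\<in>V. \<forall>z\<in>V. x \<noteq> y \<longrightarrow> y \<noteq> z \<longrightarrow> x \<noteq> z \<longrightarrow>
        c {x, y} = c {y, z} \<or> c {y, z} = c {x, z} \<or> c {x, y} = c {x, z})"

lemma rainbow_freeD:
  assumes "rainbow_free V c" "x \<in> V" "y \<in> V" "z \<in> V" "x \<noteq> y" "y \<noteq> z" "x \<noteq> z"
  shows "c {x, y} = c {y, z} \<or> c {y, z} = c {x, z} \<or> c {x, y} = c {x, z}"
  using assms unfolding rainbow_free_def by blast

lemma rainbow_free_subset: "rainbow_free V c \<Longrightarrow> U \<subseteq> V \<Longrightarrow> rainbow_free U c"
  unfolding rainbow_free_def by blast

lemma has_rainbow_triangle_iff: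
  "has_rainbow_triangle (complete_graph n) c \<longleftrightarrow> \<not> rainbow_free {..<n} c"
proof -
  have e: "{x, y} \<in> edges (complete_graph n) \<longleftrightarrow> x < n \<and> y < n \<and> x \<noteq> y" for x y
    by (auto simp: complete_graph_def card_2_iff doubleton_eq_iff)
  show ?thesis
    unfolding has_rainbow_triangle_def rainbow_free_def e by (auto 0 4)
qed

text \<open>Colourings are total functions, so their values on singletons have to be kept
  out.\<close>

definition colors :: "'a set \<Rightarrow> ('a set \<Rightarrow> 'c) \<Rightarrow> 'c set" where
  "colors V c = {c {x, y} |x y. x \<in> V \<and> y \<in> V \<and> x \<noteq> y}"

lemma colorsI: "x \<in> V \<Longrightarrow> y \<in> V \<Longrightarrow> x \<noteq> y \<Longrightarrow> c {x, y} \<in> colors V c"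
  unfolding colors_def by blast

lemma colors_mono: "U \<subseteq> V \<Longrightarrow> colors U c \<subseteq> colors V c"
  unfolding colors_def by blast

lemma finite_colors: "finite V \<Longrightarrow> finite (colors V c)"
proof -
  assume "finite V"
  then have "finite ((\<lambda>(x, y). c {x, y}) ` (V \<times> V))" by simp
  then show ?thesis by (rule finite_subset[rotated]) (auto simp: colors_def)
qed

lemma colors_complete_graph: "c ` edges (complete_graph n) = colors {..<n} c"
  unfolding edges_complete_graph colors_def by auto

text \<open>Its reflexive-transitive closure expresses that two vertices of \<open>V\<close> lie in
  the same component of colour \<open>i\<close>.\<close>

definition color_rel :: "'a set \<Rightarrow> ('a set \<Rightarrow> 'c) \<Rightarrow> 'c \<Rightarrow> ('a \<times> 'a) set" where
  "color_rel V c i = {(x, y). x \<in> V \<and> y \<in> V \<and> x \<noteq> y \<and> c {x, y} = i}"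

lemma sym_color_rel: "sym (color_rel V c i)"
  by (auto simp: sym_def color_rel_def insert_commute)

lemma color_conn_sym: "(x, y) \<in> (color_rel V c i)\<^sup>* \<Longrightarrow> (y, x) \<in> (color_rel V c i)\<^sup>*"
  by (meson sym_color_rel sym_rtrancl symD)

lemma color_conn_mem: "(x, y) \<in> (color_rel V c i)\<^sup>* \<Longrightarrow> x \<in> V \<Longrightarrow> y \<in> V"
  by (induction rule: rtrancl_induct) (auto simp: color_rel_def)

lemma color_conn_step:
  assumes "(x, y) \<in> (color_rel V c i)\<^sup>*" "y \<in> V" "v \<in> V" "v \<noteq> y" "c {v, y} = i"
  shows "(x, v) \<in> (color_rel V c i)\<^sup>*"
proof -
  have "(y, v) \<in> color_rel V c i" using assms(2-) by (simp add: color_rel_def insert_commute)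
  with assms(1) show ?thesis by (rule rtrancl.rtrancl_into_rtrancl)
qed

text \<open>Along an edge \<open>yz\<close> of the component, neither \<open>vy\<close> nor
  \<open>vz\<close> has colour \<open>i\<close>, since otherwise \<open>v\<close> would belong to
  the component; so the triangle \<open>v\<close>, \<open>y\<close>, \<open>z\<close> forces them to
  agree.\<close>

lemma color_component_module:
  assumes "rainbow_free V c" "x \<in> V" "v \<in> V"
    and "(x, y) \<in> (color_rel V c i)\<^sup>*" "(x, v) \<notin> (color_rel V c i)\<^sup>*"
  shows "c {v, y} = c {v, x}"
  using assms(4)
proof (induction rule: rtrancl_induct)
  case base
  show ?case ..
next
  case (step y z)
  have z: "(x, z) \<in> (color_rel V c i)\<^sup>*" using step by simp
  have yz: "y \<in> V" "z \<in> V" "y \<noteq> z" "c {y, z} = i" using step(2) by (auto simp: color_rel_def)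
  have ne: "v \<noteq> y" "v \<noteq> z" using assms(5) step(1) z by auto
  have "c {v, y} \<noteq> i"
    using color_conn_step[OF step(1) yz(1) assms(3) ne(1)] assms(5) by blast
  moreover have "c {v, z} \<noteq> i"
    using color_conn_step[OF z yz(2) assms(3) ne(2)] assms(5) by blast
  ultimately have "c {v, y} = c {v, z}"
    using rainbow_freeD[OF assms(1), of v y z] assms(3) yz ne by auto
  then show ?case using step.IH by simp
qed

text \<open>Either the path stays in \<open>F\<close>, or \<open>u\<close> is the vertex just before
  its first visit to \<open>v\<close>.\<close>

lemma color_conn_insert:
  assumes "(x, z) \<in> (color_rel (insert v F) c i)\<^sup>*" "x \<in> F" "v \<notin> F"
  shows "(z \<in> F \<and> (x, z) \<in> (color_rel F c i)\<^sup>*) \<or> (\<exists>u\<in>F. (x, u) \<in> (color_rel F c i)\<^sup>* \<and> c {v, u} = i)"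
  using assms(1)
proof (induction rule: rtrancl_induct)
  case base
  then show ?case using assms(2) by simp
next
  case (step y z)
  show ?case
  proof (cases "\<exists>u\<in>F. (x, u) \<in> (color_rel F c i)\<^sup>* \<and> c {v, u} = i")
    case True
    then show ?thesis by simp
  next
    case False
    then have y: "y \<in> F" "(x, y) \<in> (color_rel F c i)\<^sup>*" using step.IH by auto
    have "z \<noteq> v" using step(2) y False by (auto simp: color_rel_def insert_commute)
    then have "(y, z) \<in> color_rel F c i" using step(2) y by (auto simp: color_rel_def)
    then have "(x, z) \<in> (color_rel F c i)\<^sup>*" "z \<in> F"
      using y rtrancl.rtrancl_into_rtrancl[OF y(2)] by (auto simp: color_rel_def)
    then show ?thesis by simp
  qed
qed

text \<open>If all colours of \<open>insert v F\<close> are connected, then every component of a disconnected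
  colour \<open>i\<close> of \<open>F\<close> contains a vertex joined to \<open>v\<close> by colour \<open>i\<close>. This forces all other colours at \<open>v\<close>
  to agree.\<close>

lemma exists_disconnected_color:
  assumes "finite V" "rainbow_free V c" "card (colors V c) \<ge> 3"
  shows "\<exists>i\<in>colors V c. \<exists>x\<in>V. \<exists>y\<in>V. (x, y) \<notin> (color_rel V c i)\<^sup>*"
  using assms
proof (induction V rule: finite_induct)
  case empty
  then show ?case by (simp add: colors_def)
next
  case (insert v F)
  let ?V = "insert v F"
  show ?case
  proof (rule ccontr)
    assume "\<not> ?case"
    then have conn: "(x, y) \<in> (color_rel ?V c i)\<^sup>*" if "i \<in> colors ?V c" "x \<in> ?V" "y \<in> ?V" for i x y
      using that by blast
    have reach: "\<exists>u\<in>F. (x, u) \<in> (color_rel F c i)\<^sup>* \<and> c {v, u} = i" if "i \<in> colors ?V c" "x \<in> F" for i x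
      using color_conn_insert[OF conn, of i x v] that insert.hyps by auto
    obtain x0 where x0: "x0 \<in> F"
    proof -
      have "F \<noteq> {}"
      proof
        assume "F = {}"
        then have "colors ?V c = {}" by (auto simp: colors_def)
        then show False using insert.prems by simp
      qed
      then show ?thesis using that by blast
    qed
    have at_v: "\<exists>u\<in>F. c {v, u} = i" if "i \<in> colors ?V c" for i
      using reach[OF that x0] by blast
    have two: "\<exists>j k. j \<in> colors ?V c \<and> k \<in> colors ?V c \<and> j \<noteq> i \<and> k \<noteq> i \<and> j \<noteq> k" for i
    proof -
      have "card (colors ?V c - {i}) \<ge> 2"
        using insert.prems(2) card_Diff_singleton_if[of "colors ?V c" i] by (simp split: if_splits)
      then obtain S where S: "S \<subseteq> colors ?V c - {i}" "card S = 2" by (meson obtain_subset_with_card_n)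
      then obtain j k where "S = {j, k}" "j \<noteq> k" by (meson card_2_iff)
      then show ?thesis using S by blast
    qed
    show False
    proof (cases "card (colors F c) \<ge> 3")
      case True
      have rf: "rainbow_free F c" using insert.prems(1) rainbow_free_subset by blast
      from insert.IH[OF rf True] obtain i a b where i: "i \<in> colors F c" and ab: "a \<in> F" "b \<in> F"
        and nab: "(a, b) \<notin> (color_rel F c i)\<^sup>*" by blast
      let ?E = "(color_rel F c i)\<^sup>*"
      have iV: "i \<in> colors ?V c" using i colors_mono[of F ?V c] by auto
      \<comment> \<open>The component of \<open>z\<close> contains some \<open>u\<close> with
        \<open>vu\<close> of colour \<open>i\<close>. The triangle \<open>v\<close>,
        \<open>y\<close>, \<open>u\<close> gives \<open>yu\<close> the colour of \<open>vy\<close>,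
        and \<open>y\<close> sees the whole component of \<open>z\<close> in one colour.\<close>
      have out: "c {y, z} = c {v, y}" if y: "y \<in> F" "c {v, y} \<noteq> i" and z: "z \<in> F" "(y, z) \<notin> ?E" for y z
      proof -
        obtain u where u: "u \<in> F" "(z, u) \<in> ?E" "c {v, u} = i" using reach[OF iV z(1)] by blast
        have nyu: "(y, u) \<notin> ?E" using u z(2) color_conn_sym by (metis rtrancl_trans)
        then have "(y, u) \<notin> color_rel F c i" "y \<noteq> u" by auto
        then have "c {y, u} \<noteq> i" using y u by (auto simp: color_rel_def)
        then have "c {y, u} = c {v, y}"
          using rainbow_freeD[OF insert.prems(1), of v y u] y u insert.hyps \<open>y \<noteq> u\<close> by fastforce
        moreover have "c {y, u} = c {y, z}"
          using color_component_module[OF rf z(1) y(1) u(2)] z(2) color_conn_sym by metis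
        ultimately show ?thesis by simp
      qed
      obtain j k where jk: "j \<in> colors ?V c" "k \<in> colors ?V c" "j \<noteq> i" "k \<noteq> i" "j \<noteq> k" using two by blast
      obtain y where y: "y \<in> F" "c {v, y} = j" using at_v jk by blast
      obtain y' where y': "y' \<in> F" "c {v, y'} = k" using at_v jk by blast
      show False
      \<comment> \<open>In different components, the edge between \<open>y\<close> and
        \<open>y'\<close> would have both colours \<open>j\<close> and \<open>k\<close>. In the same
        component, any \<open>z\<close> of another component would have to see both vertices in one
        colour.\<close>
      proof (cases "(y, y') \<in> ?E")
        case False
        then have "(y', y) \<notin> ?E" using color_conn_sym by metis
        then have "c {y', y} = k" using out y' y jk by metis
        moreover have "c {y, y'} = j" using out False y' y jk by metis
        ultimately show False using jk by (simp add: insert_commute)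
      next
        case True
        obtain z where z: "z \<in> F" "(y, z) \<notin> ?E"
          using ab nab color_conn_sym by (metis rtrancl_trans)
        then have z': "(y', z) \<notin> ?E" using True by (meson rtrancl_trans)
        have "c {y, z} = j" "c {y', z} = k" using out z z' y y' jk by metis+
        moreover have "c {z, y'} = c {z, y}" using color_component_module[OF rf y(1) z(1) True z(2)] .
        ultimately show False using jk by (simp add: insert_commute)
      qed
    next
      \<comment> \<open>Here some colour \<open>i\<close> occurs only at \<open>v\<close>. Its
        components in \<open>F\<close> are single vertices, so all edges at \<open>v\<close> have
        colour \<open>i\<close>, although every colour occurs at \<open>v\<close>.\<close>
      case False
      have "\<not> colors ?V c \<subseteq> colors F c"
        using False insert.prems(2) card_mono[OF finite_colors[OF insert.hyps(1)]] by (meson le_trans)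
      then obtain i where i: "i \<in> colors ?V c" "i \<notin> colors F c" by blast
      then have "color_rel F c i = {}" by (auto simp: color_rel_def colors_def)
      then have all: "c {v, u} = i" if "u \<in> F" for u
        using reach[OF i(1) that] by auto
      obtain j where "j \<in> colors ?V c" "j \<noteq> i" using two by blast
      then show False using at_v all by blast
    qed
  qed
qed

text \<open>The function \<open>p\<close> labels the vertices by the parts of a Gallai partition.\<close>

lemma gallai_partition:
  assumes "finite V" "card V \<ge> 2" "rainbow_free V c"
  shows "\<exists>(p :: 'a \<Rightarrow> 'a) D. card D \<le> 2 \<and> D \<subseteq> colors V c \<and> (\<exists>x\<in>V. \<exists>y\<in>V. p x \<noteq> p y) \<and>
    (\<forall>x\<in>V. \<forall>y\<in>V. p x \<noteq> p y \<longrightarrow> c {x, y} \<in> D) \<and>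
    (\<forall>x\<in>V. \<forall>x'\<in>V. \<forall>y\<in>V. \<forall>y'\<in>V. p x = p x' \<longrightarrow> p y = p y' \<longrightarrow> p x \<noteq> p y \<longrightarrow> c {x, y} = c {x', y'})"
  using assms
proof (induction "card V" arbitrary: V rule: less_induct)
  case less
  show ?case
  proof (cases "card (colors V c) \<ge> 3")
    case False
    \<comment> \<open>With at most two colours the partition into singletons will do.\<close>
    have "\<exists>x\<in>V. \<exists>y\<in>V. x \<noteq> y"
      using less.prems(2) by (metis card_2_iff' obtain_subset_with_card_n subsetD)
    then show ?thesis using False
      by (intro exI[of _ id] exI[of _ "colors V c"]) (auto intro: colorsI)
  next
    case True
    obtain i a b where i: "i \<in> colors V c" and ab: "a \<in> V" "b \<in> V"
      and nab: "(a, b) \<notin> (color_rel V c i)\<^sup>*"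
      using exists_disconnected_color[OF less.prems(1,3) True] by blast
    let ?E = "(color_rel V c i)\<^sup>*"
    \<comment> \<open>The choice depends only on the component of \<open>x\<close>, so this picks
      one representative per component of colour \<open>i\<close>.\<close>
    define rep where "rep x = (SOME z. (x, z) \<in> ?E)" for x
    have rep: "(x, rep x) \<in> ?E" for x unfolding rep_def by (rule someI[of _ x]) simp
    have rep_eq: "rep x = rep y \<longleftrightarrow> (x, y) \<in> ?E" for x y
    proof
      assume "rep x = rep y"
      then show "(x, y) \<in> ?E" using rep color_conn_sym by (metis rtrancl_trans)
    next
      assume "(x, y) \<in> ?E"
      then have "(x, z) \<in> ?E \<longleftrightarrow> (y, z) \<in> ?E" for z using color_conn_sym by (metis rtrancl_trans)
      then show "rep x = rep y" unfolding rep_def by simp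
    qed
    have rep_mem: "rep x \<in> V" if "x \<in> V" for x using rep color_conn_mem that by metis
    have rep_rep: "rep (rep x) = rep x" for x using rep rep_eq by metis
    let ?T = "rep ` V"
    have T: "?T \<subseteq> V" using rep_mem by auto
    have c_rep: "c {rep x, rep y} = c {x, y}" if "x \<in> V" "y \<in> V" "rep x \<noteq> rep y" for x y
    proof -
      have "c {y, rep x} = c {y, x}"
        using color_component_module[OF less.prems(3), of x y "rep x" i] that rep rep_eq by blast
      moreover have "c {rep x, rep y} = c {rep x, y}"
        using color_component_module[OF less.prems(3), of y "rep x" "rep y" i] that rep rep_eq rep_mem rep_rep
        by metis
      ultimately show ?thesis by (simp add: insert_commute)
    qed
    \<comment> \<open>Colour \<open>i\<close> occurs, so two vertices share a representative and the
      induction hypothesis applies to the set of representatives; its partition is then pulled back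
      along \<open>rep\<close>.\<close>
    obtain u w where uw: "u \<in> V" "w \<in> V" "u \<noteq> w" "c {u, w} = i" using i unfolding colors_def by blast
    then have "rep u = rep w" unfolding rep_eq by (auto simp: color_rel_def)
    then have "\<not> inj_on rep V" using uw by (auto simp: inj_on_def)
    then have "card ?T < card V" using less.prems(1) card_image_le eq_card_imp_inj_on le_neq_implies_less by metis
    moreover have "card ?T \<ge> 2"
    proof -
      have "rep a \<noteq> rep b" using nab rep_eq by simp
      moreover have "card {rep a, rep b} \<le> card ?T" using ab less.prems(1) by (intro card_mono) auto
      ultimately show ?thesis by simp
    qed
    ultimately obtain p :: "'a \<Rightarrow> 'a" and D where D: "card D \<le> 2" "D \<subseteq> colors ?T c"
      and ex: "\<exists>x\<in>?T. \<exists>y\<in>?T. p x \<noteq> p y"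
      and pD: "\<forall>x\<in>?T. \<forall>y\<in>?T. p x \<noteq> p y \<longrightarrow> c {x, y} \<in> D"
      and pm: "\<forall>x\<in>?T. \<forall>x'\<in>?T. \<forall>y\<in>?T. \<forall>y'\<in>?T. p x = p x' \<longrightarrow> p y = p y' \<longrightarrow> p x \<noteq> p y \<longrightarrow>
        c {x, y} = c {x', y'}"
      using less.hyps[OF _ finite_imageI[OF less.prems(1)] _ rainbow_free_subset[OF less.prems(3) T]]
      by (elim exE conjE meta_impE) (assumption | blast)+
    show ?thesis
    proof (intro exI[of _ "p \<circ> rep"] exI[of _ D] conjI ballI impI)
      show "card D \<le> 2" by fact
      show "D \<subseteq> colors V c" using D(2) colors_mono[OF T, of c] by blast
      show "\<exists>x\<in>V. \<exists>y\<in>V. (p \<circ> rep) x \<noteq> (p \<circ> rep) y" using ex by auto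
      show "c {x, y} \<in> D" if "x \<in> V" "y \<in> V" "(p \<circ> rep) x \<noteq> (p \<circ> rep) y" for x y
        using pD that c_rep[of x y] by (metis comp_apply imageI)
      show "c {x, y} = c {x', y'}" if "x \<in> V" "x' \<in> V" "y \<in> V" "y' \<in> V" "(p \<circ> rep) x = (p \<circ> rep) x'"
        "(p \<circ> rep) y = (p \<circ> rep) y'" "(p \<circ> rep) x \<noteq> (p \<circ> rep) y" for x x' y y'
      proof -
        have "c {rep x, rep y} = c {rep x', rep y'}"
          by (rule pm[rule_format]) (use that in auto)
        moreover have "rep x \<noteq> rep y" "rep x' \<noteq> rep y'" using that by auto
        ultimately show ?thesis using c_rep[of x y] c_rep[of x' y'] that by simp
      qed
    qed
  qed
qed

subsection \<open>Two-colourings with small codegrees\<close>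

text \<open>The edge \<open>ij\<close> is red or blue according to \<open>g i j\<close>; the values \<open>g i i\<close> count as well,
  because they become proper entries when the matrix is doubled.\<close>

definition codegree_bounded :: "nat \<Rightarrow> nat \<Rightarrow> (nat \<Rightarrow> nat \<Rightarrow> bool) \<Rightarrow> bool" where
  "codegree_bounded n M g \<longleftrightarrow> (\<forall>i j. g i j = g j i) \<and>
     (\<forall>s. \<forall>i<n. (\<Sum>w<n. of_bool (g i w = s)) \<le> 2 * M) \<and>
     (\<forall>s. \<forall>i<n. \<forall>j<n. i \<noteq> j \<longrightarrow> (\<Sum>w<n. of_bool (g i w = s \<and> g j w = s)) \<le> M)"

lemma sum_lessThan_double:
  fixes f :: "nat \<Rightarrow> nat"
  shows "(\<Sum>w<2*n. f w) = (\<Sum>w<n. f w) + (\<Sum>w<n. f (n + w))"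
proof -
  have "sum f {0..<2*n} = sum f {0..<n} + sum f {n..<2*n}" by (simp add: sum.atLeastLessThan_concat)
  moreover have "sum f {n..<2*n} = (\<Sum>w=0..<n. f (n + w))"
    using sum.shift_bounds_nat_ivl[of f 0 n n] by (simp add: add.commute mult_2)
  ultimately show ?thesis by (simp add: atLeast0LessThan)
qed

text \<open>The Kronecker product with the Hadamard matrix of order 2 (Sylvester's construction). The bound
  on the row sums, that is on the degrees, is what keeps the codegrees of the new rows bounded.\<close>

lemma codegree_bounded_double:
  assumes "codegree_bounded n M g"
  shows "codegree_bounded (2 * n) (2 * M) (\<lambda>i j. g (i mod n) (j mod n) \<noteq> (n \<le> i \<and> n \<le> j))"
proof -
  define h where "h i j \<longleftrightarrow> g (i mod n) (j mod n) \<noteq> (n \<le> i \<and> n \<le> j)" for i j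
  have sym: "g i j = g j i" for i j using assms unfolding codegree_bounded_def by blast
  have row: "(\<Sum>w<n. of_bool (g i w = s)) \<le> 2 * M" if "i < n" for s i
    using assms that unfolding codegree_bounded_def by blast
  have cod: "(\<Sum>w<n. of_bool (g i w = s \<and> g j w = s)) \<le> M" if "i < n" "j < n" "i \<noteq> j" for s i j
    using assms that unfolding codegree_bounded_def by blast
  have row_sum: "(\<Sum>w<n. of_bool (g i w = s \<and> P w)) + (\<Sum>w<n. of_bool (g i w = s \<and> \<not> P w))
      = (\<Sum>w<n. of_bool (g i w = s) :: nat)" for i s P
    unfolding sum.distrib[symmetric] by (rule sum.cong) auto
  have half: "i < n \<or> (\<exists>i'<n. i = n + i')" if "i < 2 * n" for i
    using that by (cases "i < n") (auto intro!: exI[of _ "i - n"])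
  have lo: "h i w = g i w" "h i (n + w) = g i w" "h (n + i) w = g i w" "h (n + i) (n + w) = (\<not> g i w)"
    if "i < n" "w < n" for i w
    using that by (simp_all add: h_def)
  show ?thesis
    unfolding h_def[symmetric] codegree_bounded_def sum_lessThan_double
  proof (intro conjI allI impI)
    show "h i j = h j i" for i j unfolding h_def using sym[of "i mod n" "j mod n"] by auto
  next
    fix s i assume "i < 2 * n"
    then consider "i < n" | i' where "i' < n" "i = n + i'" using half by blast
    then show "(\<Sum>w<n. of_bool (h i w = s)) + (\<Sum>w<n. of_bool (h i (n + w) = s)) \<le> 2 * (2 * M)"
    proof cases
      case 1
      have "(\<Sum>w<n. of_bool (h i w = s)) = (\<Sum>w<n. of_bool (g i w = s) :: nat)"
        "(\<Sum>w<n. of_bool (h i (n + w) = s)) = (\<Sum>w<n. of_bool (g i w = s) :: nat)"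
        using 1 by (auto intro!: sum.cong simp: lo simp del: sum_of_bool_eq)
      then show ?thesis using row[OF 1, of s] by linarith
    next
      case 2
      have "(\<Sum>w<n. of_bool (h i w = s)) = (\<Sum>w<n. of_bool (g i' w = s) :: nat)"
        "(\<Sum>w<n. of_bool (h i (n + w) = s)) = (\<Sum>w<n. of_bool (g i' w = (\<not> s)) :: nat)"
        unfolding 2(2) using 2(1) by (auto intro!: sum.cong simp: lo simp del: sum_of_bool_eq)
      then show ?thesis using row[OF 2(1), of s] row[OF 2(1), of "\<not> s"] by linarith
    qed
  next
    \<comment> \<open>In the second half of the columns only row \<open>n + j\<close> is negated, so
      both sums together count the entries \<open>s\<close> of row \<open>i\<close> of
      \<open>g\<close>; the row bound applies.\<close>
    have mixed: "(\<Sum>w<n. of_bool (h i w = s \<and> h (n + j) w = s))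
        + (\<Sum>w<n. of_bool (h i (n + w) = s \<and> h (n + j) (n + w) = s)) \<le> 2 * M"
      if "i < n" "j < n" for s i j
    proof -
      have "(\<Sum>w<n. of_bool (h i w = s \<and> h (n + j) w = s)) = (\<Sum>w<n. of_bool (g i w = s \<and> g j w = s) :: nat)"
        "(\<Sum>w<n. of_bool (h i (n + w) = s \<and> h (n + j) (n + w) = s)) = (\<Sum>w<n. of_bool (g i w = s \<and> \<not> (g j w = s)) :: nat)"
        using that by (auto intro!: sum.cong simp: lo simp del: sum_of_bool_eq)
      then show ?thesis using row[OF that(1), of s] row_sum[of i s "\<lambda>w. g j w = s"] by linarith
    qed
    fix s i j assume i: "i < 2 * n" and j: "j < 2 * n" and ne: "i \<noteq> j"
    consider "i < n" "j < n" | j' where "i < n" "j' < n" "j = n + j'"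
      | i' where "i' < n" "i = n + i'" "j < n" | i' j' where "i' < n" "i = n + i'" "j' < n" "j = n + j'"
      using half[OF i] half[OF j] by blast
    then show "(\<Sum>w<n. of_bool (h i w = s \<and> h j w = s)) + (\<Sum>w<n. of_bool (h i (n + w) = s \<and> h j (n + w) = s)) \<le> 2 * M"
    proof cases
      case 1
      have "(\<Sum>w<n. of_bool (h i w = s \<and> h j w = s)) = (\<Sum>w<n. of_bool (g i w = s \<and> g j w = s) :: nat)"
        "(\<Sum>w<n. of_bool (h i (n + w) = s \<and> h j (n + w) = s)) = (\<Sum>w<n. of_bool (g i w = s \<and> g j w = s) :: nat)"
        using 1 by (auto intro!: sum.cong simp: lo simp del: sum_of_bool_eq)
      then show ?thesis using cod[OF 1 ne, of s] by linarith
    next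
      case 2
      then show ?thesis unfolding 2(3) using mixed[OF 2(1,2)] by simp
    next
      case 3
      have comm: "(\<Sum>w<n. of_bool (h i (f w) = s \<and> h j (f w) = s)) = (\<Sum>w<n. of_bool (h j (f w) = s \<and> h i (f w) = s) :: nat)" for f
        by (simp add: conj_commute)
      show ?thesis using mixed[OF 3(3,1), of s] unfolding 3(2)[symmetric]
        using comm[of id] comm[of "\<lambda>w. n + w"] by simp
    next
      case 4
      have "(\<Sum>w<n. of_bool (h i w = s \<and> h j w = s)) = (\<Sum>w<n. of_bool (g i' w = s \<and> g j' w = s) :: nat)"
        "(\<Sum>w<n. of_bool (h i (n + w) = s \<and> h j (n + w) = s)) = (\<Sum>w<n. of_bool (g i' w = (\<not> s) \<and> g j' w = (\<not> s)) :: nat)"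
        unfolding 4(2,4) using 4(1,3) by (auto intro!: sum.cong simp: lo simp del: sum_of_bool_eq)
      moreover have "i' \<noteq> j'" using ne 4 by auto
      ultimately show ?thesis using cod[OF 4(1,3), of s] cod[OF 4(1,3), of "\<not> s"] by linarith
    qed
  qed
qed

lemma codegree_bounded_power:
  assumes "codegree_bounded n M g"
  shows "\<exists>h. codegree_bounded (2 ^ t * n) (2 ^ t * M) h"
proof (induction t)
  case 0
  then show ?case using assms by auto
next
  case (Suc t)
  then obtain h where "codegree_bounded (2 ^ t * n) (2 ^ t * M) h" by blast
  from codegree_bounded_double[OF this] show ?case by (auto simp: mult.assoc)
qed

section \<open>Base colourings from Hankel matrices\<close>

text \<open>Dependence on \<open>i + j\<close> alone makes the matrix symmetric for every choice of
  \<open>A\<close>.\<close>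

definition hankel :: "nat \<Rightarrow> nat set \<Rightarrow> nat \<Rightarrow> nat \<Rightarrow> bool" where
  "hankel n A i j \<longleftrightarrow> (i + j) mod n \<in> A"

text \<open>An executable form of the bounds, with lists in place of sets, to be decided by
  evaluation.\<close>

definition hankel_check :: "nat \<Rightarrow> nat \<Rightarrow> nat list \<Rightarrow> bool" where
  "hankel_check n M A \<longleftrightarrow> (\<forall>s\<in>{True, False}. \<forall>i\<in>set [0..<n].
      sum_list (map (\<lambda>w. of_bool (hankel n (set A) i w = s)) [0..<n]) \<le> 2 * M \<and>
      (\<forall>j\<in>set [0..<n]. i \<noteq> j \<longrightarrow>
        sum_list (map (\<lambda>w. of_bool (hankel n (set A) i w = s \<and> hankel n (set A) j w = s)) [0..<n]) \<le> M))"

lemma codegree_bounded_hankel: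
  assumes "hankel_check n M A"
  shows "codegree_bounded n M (hankel n (set A))"
proof -
  have s: "(\<Sum>w<n. f w) = sum_list (map f [0..<n])" for f :: "nat \<Rightarrow> nat"
    by (simp add: interv_sum_list_conv_sum_set_nat atLeast0LessThan)
  show ?thesis using assms unfolding codegree_bounded_def hankel_check_def s
    by (simp add: hankel_def add.commute atLeast0LessThan Ball_def all_bool_eq)
qed


text \<open>These sets were found by exhaustive search. Doubled \<open>t\<close> times, the last three provide
  colourings on \<open>3 * M\<close> vertices for \<open>M\<close> in \<open>2^t * [3, 4]\<close>, \<open>2^t * [4, 5]\<close> and \<open>2^t * [5, 6]\<close>,
  which exhaust all \<open>M \<ge> 3\<close>.\<close>

lemma hankel_6_2: "hankel_check 6 2 [0, 1, 2]" by code_simp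
lemma hankel_12_3: "hankel_check 12 3 [0, 1, 2, 4, 5, 7]" by code_simp
lemma hankel_15_4: "hankel_check 15 4 [0, 1, 2, 4, 5, 8, 10]" by code_simp
lemma hankel_18_5: "hankel_check 18 5 [0, 1, 2, 4, 5, 6, 8, 9, 11]" by code_simp

lemma exists_codegree_bounded:
  assumes "M \<ge> 2"
  shows "\<exists>n M' g. n \<ge> 3 * M \<and> M' \<le> M \<and> codegree_bounded n M' g"
proof (cases "M = 2")
  case True
  then show ?thesis using codegree_bounded_hankel[OF hankel_6_2] by (intro exI[of _ 6] exI[of _ 2]) auto
next
  case False
  have "\<exists>t. 3 * 2 ^ t \<le> M \<and> M < 6 * 2 ^ t"
  proof -
    have "\<exists>t. 2 ^ t \<le> M div 3 \<and> M div 3 < 2 ^ (t + 1)"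
      using ex_power_ivl1[of 2 "M div 3"] assms False by auto
    then obtain t where "2 ^ t \<le> M div 3" "M div 3 < 2 ^ (t + 1)" by blast
    then have "3 * 2 ^ t \<le> M" "M < 6 * 2 ^ t" by auto
    then show ?thesis by blast
  qed
  then obtain t where t: "3 * 2 ^ t \<le> M" "M < 6 * 2 ^ t" by blast
  \<comment> \<open>In each range the order \<open>2 ^ t * n\<close> is at least
    \<open>3 * M\<close> while the codegree bound is still at most \<open>M\<close>.\<close>
  consider "M \<le> 2 ^ t * 4" | "2 ^ t * 4 \<le> M" "M \<le> 2 ^ t * 5" | "2 ^ t * 5 \<le> M" by linarith
  then show ?thesis
  proof cases
    case 1
    obtain h where "codegree_bounded (2 ^ t * 12) (2 ^ t * 3) h"
      using codegree_bounded_power[OF codegree_bounded_hankel[OF hankel_12_3]] by blast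
    then show ?thesis using t 1 by (intro exI conjI) (auto simp: mult.commute)
  next
    case 2
    obtain h where "codegree_bounded (2 ^ t * 15) (2 ^ t * 4) h"
      using codegree_bounded_power[OF codegree_bounded_hankel[OF hankel_15_4]] by blast
    then show ?thesis using 2 by (intro exI conjI[rotated] ) auto
  next
    case 3
    obtain h where "codegree_bounded (2 ^ t * 18) (2 ^ t * 5) h"
      using codegree_bounded_power[OF codegree_bounded_hankel[OF hankel_18_5]] by blast
    then show ?thesis using t 3 by (intro exI conjI[rotated]) auto
  qed
qed

subsection \<open>Ramsey numbers of complete bipartite graphs\<close>

lemma mono_bip_card:
  assumes "mono_bip l m V c" "finite V"
  shows "l + m \<le> card V"
  using assms(1)
proof (rule mono_bipE)
  fix X Y assume XY: "X \<subseteq> V" "Y \<subseteq> V" "X \<inter> Y = {}" "card X = l" "card Y = m"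
  have fin: "finite X" "finite Y" using XY assms(2) finite_subset by blast+
  have "card (X \<union> Y) \<le> card V" using XY assms(2) by (intro card_mono) auto
  then show ?thesis using card_Un_disjoint[OF fin XY(3)] XY by simp
qed

lemma mono_bip_monochromatic:
  assumes "finite V" "l + m \<le> card V" "colors V c \<subseteq> {i}"
  shows "mono_bip l m V c"
proof -
  obtain X where X: "X \<subseteq> V" "card X = l" using assms(2) obtain_subset_with_card_n[of l V] by auto
  then have "m \<le> card (V - X)" using assms(1,2) by (simp add: card_Diff_subset finite_subset)
  moreover have "c {x, y} = i" if "x \<in> X" "y \<in> V - X" for x y
    using colorsI[of x V y c] that X(1) assms(3) by auto
  ultimately show ?thesis
    using X by (intro mono_bip_leI[of X V "V - X" l m c i]) auto
qed

text \<open>Guarantees that the \<open>LEAST\<close> in the Ramsey number is attained: a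
  monochromatic complete graph on \<open>l + m\<close> vertices contains a copy.\<close>

lemma exists_ramsey_complete_bipartite:
  "\<exists>n :: nat. \<forall>c. colors {..<n} c \<subseteq> {0, 1} \<longrightarrow> mono_bip l m {..<n} c"
proof -
  obtain r where r: "\<forall>(V :: nat set) E. finite V \<and> card V \<ge> r \<longrightarrow>
      (\<exists>S\<subseteq>V. card S = l + m \<and> clique S E \<or> card S = l + m \<and> indep S E)"
    using ramsey2[of "l + m" "l + m", where 'a = nat] by (elim exE conjE) (rule that)
  have "mono_bip l m {..<r} c" if c: "colors {..<r} c \<subseteq> {0, 1}" for c
  proof -
    obtain S where S: "S \<subseteq> {..<r}" "card S = l + m" and
      *: "clique S {e. c e = 0} \<or> indep S {e. c e = 0}"
      using r[rule_format, of "{..<r}" "{e. c e = 0}"] by auto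
    have "colors S c \<subseteq> {0, 1}" using colors_mono[OF S(1), of c] c by (rule order.trans)
    then have "colors S c \<subseteq> {0} \<or> colors S c \<subseteq> {1}"
    proof -
      have "c {x, y} \<in> {0, 1}" if "x \<in> S" "y \<in> S" "x \<noteq> y" for x y
        using \<open>colors S c \<subseteq> {0, 1}\<close> by (rule subsetD) (use that in \<open>rule colorsI\<close>)
      moreover from * have "(\<forall>x\<in>S. \<forall>y\<in>S. x \<noteq> y \<longrightarrow> c {x, y} = 0) \<or> (\<forall>x\<in>S. \<forall>y\<in>S. x \<noteq> y \<longrightarrow> c {x, y} \<noteq> 0)"
        by (simp add: clique_def indep_def)
      ultimately have "(\<forall>x\<in>S. \<forall>y\<in>S. x \<noteq> y \<longrightarrow> c {x, y} = 0) \<or> (\<forall>x\<in>S. \<forall>y\<in>S. x \<noteq> y \<longrightarrow> c {x, y} = 1)"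
        by blast
      then show ?thesis by (rule disj_forward) (auto simp: colors_def)
    qed
    moreover have "finite S" using S(1) finite_subset by blast
    ultimately have "mono_bip l m S c"
      using mono_bip_monochromatic[of S l m c 0] mono_bip_monochromatic[of S l m c 1] S(2) by auto
    then show ?thesis using mono_bip_mono S(1) by blast
  qed
  then show ?thesis by blast
qed

lemma ramsey_number_complete_bipartite:
  "ramsey_number (complete_bipartite l m) =
    (LEAST n. \<forall>c. colors {..<n} c \<subseteq> {0, 1} \<longrightarrow> mono_bip l m {..<n} c)"
  unfolding ramsey_number_def has_mono_copy_complete_bipartite_iff colors_complete_graph ..

text \<open>Transfers the defining property of the Ramsey number to any vertex set that is large
  enough and to any pair of colours.\<close>

lemma mono_bip_of_two_colors:
  assumes "finite T" "ramsey_number (complete_bipartite l m) \<le> card T" "colors T c \<subseteq> D" "card D = 2"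
  shows "mono_bip l m T c"
proof -
  let ?R = "ramsey_number (complete_bipartite l m)"
  obtain T' where T': "T' \<subseteq> T" "card T' = ?R" using assms(2) by (meson obtain_subset_with_card_n)
  have "finite T'" using T' assms(1) finite_subset by blast
  then obtain h where h: "bij_betw h {..<?R} T'"
    using ex_bij_betw_nat_finite[of T'] T' by (auto simp: atLeast0LessThan)
  obtain d0 d1 where D: "D = {d0, d1}" using assms(4) by (meson card_2_iff)
  define c' :: "nat set \<Rightarrow> nat" where "c' e = (if c (h ` e) = d0 then 0 else 1)" for e
  have "colors {..<?R} c' \<subseteq> {0, 1}" by (auto simp: colors_def c'_def)
  moreover have "\<forall>c. colors {..<?R} c \<subseteq> {0, 1} \<longrightarrow> mono_bip l m {..<?R} c"
    unfolding ramsey_number_complete_bipartite by (rule LeastI_ex) (rule exists_ramsey_complete_bipartite)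
  ultimately have "mono_bip l m {..<?R} c'" by blast
  then obtain X Y i where XY: "X \<subseteq> {..<?R}" "Y \<subseteq> {..<?R}" "X \<inter> Y = {}" "card X = l" "card Y = m"
    and i [rule_format]: "\<forall>x\<in>X. \<forall>y\<in>Y. c' {x, y} = i" by (rule mono_bipE)
  have inj: "inj_on h {..<?R}" and im: "h ` {..<?R} = T'" using h by (auto simp: bij_betw_def)
  have col: "c {h x, h y} = (if i = 0 then d0 else d1)" if "x \<in> X" "y \<in> Y" for x y
  proof -
    have "x \<in> {..<?R}" "y \<in> {..<?R}" "x \<noteq> y" using that XY by auto
    then have "h x \<in> T" "h y \<in> T" "h x \<noteq> h y"
      using im T'(1) inj_onD[OF inj, of x y] by auto
    then have "c {h x, h y} \<in> D" using subsetD[OF assms(3) colorsI[of "h x" T "h y" c]] by blast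
    then show ?thesis using i[OF that] D by (auto simp: c'_def split: if_splits)
  qed
  have "h ` X \<inter> h ` Y = {}" using inj_on_image_Int[OF inj XY(1,2)] XY(3) by simp
  moreover have "card (h ` X) = l" "card (h ` Y) = m"
    using XY card_image[OF inj_on_subset[OF inj XY(1)]] card_image[OF inj_on_subset[OF inj XY(2)]] by auto
  moreover have "h ` X \<subseteq> T" "h ` Y \<subseteq> T" using XY(1,2) im T'(1) by auto
  ultimately show ?thesis using col
    by (intro mono_bipI[of "h ` X" T "h ` Y" l m c "if i = 0 then d0 else d1"]) auto
qed

lemma less_ramsey_number:
  assumes "colors {..<n} c \<subseteq> {0, 1}" "\<not> mono_bip l m {..<n} c"
  shows "n < ramsey_number (complete_bipartite l m)"
  using mono_bip_of_two_colors[of "{..<n}" l m c "{0, 1}"] assms by fastforce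

text \<open>On \<open>l + m - 1\<close> vertices there is no room for a copy, so even a constant
  colouring avoids it.\<close>

lemma ramsey_number_ge_order:
  assumes "l \<ge> 1"
  shows "l + m \<le> ramsey_number (complete_bipartite l m)"
proof -
  have "\<not> mono_bip l m {..<l + m - 1} (\<lambda>_. 0)"
    using mono_bip_card[of l m "{..<l + m - 1}" "\<lambda>_. 0"] assms by auto
  then have "l + m - 1 < ramsey_number (complete_bipartite l m)"
    by (rule less_ramsey_number[rotated]) (auto simp: colors_def)
  then show ?thesis by simp
qed

text \<open>Colour 0 inside two halves of size \<open>m - 1\<close> and colour 1 between them: a
  single vertex of \<open>X\<close> already confines \<open>Y\<close> to one half.\<close>

lemma ramsey_number_gt_double:
  assumes "l \<ge> 1" "m \<ge> 1"
  shows "2 * (m - 1) < ramsey_number (complete_bipartite l m)"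
proof -
  let ?V = "{..<2 * (m - 1)}"
  define f :: "nat \<Rightarrow> bool" where "f v \<longleftrightarrow> v < m - 1" for v
  define c :: "nat set \<Rightarrow> nat" where "c e = of_bool (card (f ` e) = 2)" for e
  have c: "c {x, y} = of_bool (f x \<noteq> f y)" for x y
    by (auto simp: c_def card_insert_if)
  have half: "card {v \<in> ?V. f v = s} = m - 1" for s
  proof (cases s)
    case True
    then have "{v \<in> ?V. f v = s} = {..<m - 1}" by (auto simp: f_def)
    then show ?thesis by simp
  next
    case False
    then have "{v \<in> ?V. f v = s} = {m - 1..<2 * (m - 1)}" by (auto simp: f_def)
    then show ?thesis by simp
  qed
  have "\<not> mono_bip l m ?V c"
  proof
    assume "mono_bip l m ?V c"
    then obtain X Y i where XY: "X \<subseteq> ?V" "Y \<subseteq> ?V" "X \<inter> Y = {}" "card X = l" "card Y = m"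
      and i [rule_format]: "\<forall>x\<in>X. \<forall>y\<in>Y. c {x, y} = i" by (rule mono_bipE)
    obtain x where x: "x \<in> X" using XY(4) assms(1) by fastforce
    have "Y \<subseteq> {v \<in> ?V. f v = (f x = (i = 0))}"
    proof
      fix y assume y: "y \<in> Y"
      then have "i = of_bool (f x \<noteq> f y)" using i[OF x y] c by simp
      then show "y \<in> {v \<in> ?V. f v = (f x = (i = 0))}" using y XY(2) by auto
    qed
    then have "card Y \<le> card {v \<in> ?V. f v = (f x = (i = 0))}" by (intro card_mono) auto
    then have "card Y \<le> m - 1" using half by simp
    then show False using XY(5) assms(2) by simp
  qed
  then show ?thesis by (rule less_ramsey_number[rotated]) (auto simp: colors_def c_def)
qed

text \<open>Two vertices of \<open>X\<close> have all of \<open>Y\<close> as common neighbours in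
  one colour, but codegrees are at most \<open>m - 1\<close>.\<close>

lemma ramsey_number_gt_triple:
  assumes "l \<ge> 2" "m \<ge> 3"
  shows "3 * (m - 1) < ramsey_number (complete_bipartite l m)"
proof -
  obtain n M g where nM: "3 * (m - 1) \<le> n" "M \<le> m - 1" and g: "codegree_bounded n M g"
  proof -
    have "2 \<le> m - 1" using assms(2) by simp
    from exists_codegree_bounded[OF this] show ?thesis using that by blast
  qed
  let ?V = "{..<3 * (m - 1)}"
  \<comment> \<open>\<open>Min\<close> and \<open>Max\<close> recover the endpoints of an edge;
    their order is immaterial as \<open>g\<close> is symmetric.\<close>
  define c :: "nat set \<Rightarrow> nat" where "c e = of_bool (g (Min e) (Max e))" for e
  have sym: "g i j = g j i" for i j using g unfolding codegree_bounded_def by blast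
  have c: "c {x, y} = of_bool (g x y)" for x y
    using sym by (simp add: c_def min_def max_def)
  have "\<not> mono_bip l m ?V c"
  proof
    assume "mono_bip l m ?V c"
    then obtain X Y i where XY: "X \<subseteq> ?V" "Y \<subseteq> ?V" "X \<inter> Y = {}" "card X = l" "card Y = m"
      and i [rule_format]: "\<forall>x\<in>X. \<forall>y\<in>Y. c {x, y} = i" by (rule mono_bipE)
    obtain Z where Z: "Z \<subseteq> X" "card Z = 2" using XY(4) assms(1) obtain_subset_with_card_n[of 2 X] by blast
    then obtain x x' where x: "x \<in> X" "x' \<in> X" "x \<noteq> x'" unfolding card_2_iff by blast
    let ?W = "{w \<in> {..<n}. g x w = (i = 1) \<and> g x' w = (i = 1)}"
    have "Y \<subseteq> ?W"
    proof
      fix y assume y: "y \<in> Y"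
      have "i = of_bool (g x y)" "i = of_bool (g x' y)"
        using i[OF x(1) y] i[OF x(2) y] by (simp_all add: c)
      moreover have "y < n" using y XY(2) nM(1) by auto
      ultimately show "y \<in> ?W" by (cases "g x y"; cases "g x' y") auto
    qed
    then have "card Y \<le> card ?W" by (intro card_mono) auto
    also have "card ?W = (\<Sum>w<n. of_bool (g x w = (i = 1) \<and> g x' w = (i = 1)))"
      by (simp add: Collect_conj_eq[symmetric] Int_def)
    also have "\<dots> \<le> M"
    proof -
      have "x < n" "x' < n" using x XY(1) nM(1) by auto
      then show ?thesis using g x(3) unfolding codegree_bounded_def by blast
    qed
    finally show False using XY(5) nM(2) assms(2) by simp
  qed
  then show ?thesis by (rule less_ramsey_number[rotated]) (auto simp: colors_def c_def)
qed

subsection \<open>The upper bound\<close>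

lemma card_le_of_small_classes:
  assumes "finite W" "\<And>w. w \<in> W \<Longrightarrow> card {v \<in> W. q v = q w} \<le> s"
  shows "card W \<le> card (q ` W) * s"
proof -
  have "card W = (\<Sum>t\<in>q ` W. card {v \<in> W. q v = t})"
    using sum.image_gen[OF assms(1), of "\<lambda>_. 1 :: nat" q] by simp
  also have "\<dots> \<le> (\<Sum>t\<in>q ` W. s)" using assms(2) by (intro sum_mono) auto
  finally show ?thesis by simp
qed

definition is_module :: "'a set \<Rightarrow> ('a set \<Rightarrow> 'c) \<Rightarrow> 'a set \<Rightarrow> bool" where
  "is_module V c A \<longleftrightarrow> A \<subseteq> V \<and> (\<forall>v\<in>V - A. \<forall>x\<in>A. \<forall>y\<in>A. c {v, x} = c {v, y})"

text \<open>The set \<open>A\<close> and the outside vertices that see it in colour \<open>i\<close>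
  span a monochromatic complete bipartite graph; \<open>A\<close> may serve as either side.\<close>

lemma card_module_neighbours:
  assumes V: "finite V" and A: "is_module V c A" "a \<in> A" and lm: "l \<le> card A"
    and no: "\<not> mono_bip l m V c" "\<not> mono_bip m l V c"
  shows "card {v \<in> V - A. c {v, a} = i} \<le> m - 1"
    and "m \<le> card A \<Longrightarrow> card {v \<in> V - A. c {v, a} = i} \<le> l - 1"
proof -
  let ?S = "{v \<in> V - A. c {v, a} = i}"
  have AV: "A \<subseteq> V" "finite A" using A(1) V finite_subset by (auto simp: is_module_def)
  have col: "c {x, y} = i" if "x \<in> A" "y \<in> ?S" for x y
  proof -
    have "c {y, x} = c {y, a}" using A that unfolding is_module_def by blast
    then show ?thesis using that by (simp add: insert_commute)
  qed
  have "\<not> m \<le> card ?S"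
  proof
    assume "m \<le> card ?S"
    then have "mono_bip l m V c"
      using AV lm col by (intro mono_bip_leI[of A V ?S l m c i]) auto
    then show False using no by simp
  qed
  then show "card ?S \<le> m - 1" by simp
  show "card ?S \<le> l - 1" if "m \<le> card A"
  proof -
    have "\<not> l \<le> card ?S"
    proof
      assume "l \<le> card ?S"
      then have "mono_bip m l V c"
        using AV that col by (intro mono_bip_leI[of A V ?S m l c i]) auto
      then show False using no by simp
    qed
    then show ?thesis by simp
  qed
qed

theorem card_rainbow_free_le:
  fixes V :: "'a set" and c :: "'a set \<Rightarrow> nat"
  assumes V: "finite V" and rf: "rainbow_free V c" and K: "finite K" "colors V c \<subseteq> K" "card K \<ge> 2"
    and no: "\<not> mono_bip l m V c" and lm: "2 \<le> l" "l \<le> m"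
  defines "R \<equiv> ramsey_number (complete_bipartite l m)"
  shows "card V \<le> (R - 1 + (card K - 2)) * (l - 1)"
proof (cases "card V < m")
  case True
  have "card V \<le> (R - 1) * 1"
    using True ramsey_number_ge_order[of l m] lm unfolding R_def by linarith
  also have "\<dots> \<le> (R - 1 + (card K - 2)) * (l - 1)"
    using lm by (intro mult_mono) auto
  finally show ?thesis .
next
  case False
  have no': "\<not> mono_bip m l V c" using no mono_bip_commute by blast
  have "\<exists>A. is_module V c A \<and> m \<le> card A" using False by (intro exI[of _ V]) (auto simp: is_module_def)
  then obtain A where A: "is_module V c A" "m \<le> card A"
    and Amin: "\<And>B. is_module V c B \<Longrightarrow> m \<le> card B \<Longrightarrow> card A \<le> card B"
    using ex_has_least_nat[of "\<lambda>A. is_module V c A \<and> m \<le> card A" _ card] by blast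
  have AV: "A \<subseteq> V" "finite A" using A(1) V finite_subset by (auto simp: is_module_def)
  have A2: "card A \<ge> 2" using A(2) lm by simp
  obtain p :: "'a \<Rightarrow> 'a" and D0 where D0: "card D0 \<le> 2" "D0 \<subseteq> colors A c"
    and pne: "\<exists>x\<in>A. \<exists>y\<in>A. p x \<noteq> p y"
    and pD: "\<forall>x\<in>A. \<forall>y\<in>A. p x \<noteq> p y \<longrightarrow> c {x, y} \<in> D0"
    and pm: "\<forall>x\<in>A. \<forall>x'\<in>A. \<forall>y\<in>A. \<forall>y'\<in>A. p x = p x' \<longrightarrow> p y = p y' \<longrightarrow> p x \<noteq> p y \<longrightarrow> c {x, y} = c {x', y'}"
    using gallai_partition[OF AV(2) A2 rainbow_free_subset[OF rf AV(1)]]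
    by (elim exE conjE) (assumption | blast)+
  have "D0 \<subseteq> K" using D0(2) colors_mono[OF AV(1), of c] K(2) by blast
  \<comment> \<open>The partition may use fewer than two colours; padding to exactly two leaves
    \<open>card K - 2\<close> colours outside \<open>D\<close>.\<close>
  then obtain D where D: "D0 \<subseteq> D" "D \<subseteq> K" "card D = 2"
    using exists_subset_between[OF D0(1) K(3) _ K(1)] by blast
  have finD: "finite D" using D(3) by (metis card.infinite zero_neq_numeral)
  obtain a where a: "a \<in> A" using A2 by fastforce
  define S where "S i = {v \<in> V - A. c {v, a} = i}" for i
  have cardS: "card (S i) \<le> l - 1" for i
    using card_module_neighbours(2)[OF V A(1) a _ no no' A(2)] A(2) lm unfolding S_def by simp
  have outside: "c {v, a} \<in> K" if "v \<in> V - A" for v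
    using that a AV(1) K(2) colorsI[of v V a c] by auto
  define W where "W = A \<union> (\<Union>i\<in>D. S i)"
  have WV: "W \<subseteq> V" using AV(1) by (auto simp: W_def S_def)
  then have finW: "finite W" using V finite_subset by blast
  have "V \<subseteq> W \<union> (\<Union>i\<in>K - D. S i)" using outside by (auto simp: W_def S_def)
  moreover have finSK: "finite (\<Union>i\<in>K - D. S i)" using K(1) V by (auto simp: S_def)
  ultimately have "card V \<le> card (W \<union> (\<Union>i\<in>K - D. S i))" using finW by (intro card_mono) auto
  also have "\<dots> \<le> card W + card (\<Union>i\<in>K - D. S i)" by (rule card_Un_le)
  also have "card (\<Union>i\<in>K - D. S i) \<le> (\<Sum>i\<in>K - D. card (S i))" using K(1) by (intro card_UN_le) auto
  also have "\<dots> \<le> (\<Sum>i\<in>K - D. l - 1)" using cardS by (intro sum_mono) auto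
  also have "\<dots> = (card K - 2) * (l - 1)" using D finD by (simp add: card_Diff_subset)
  finally have cardV: "card V \<le> card W + (card K - 2) * (l - 1)" by simp
  \<comment> \<open>The labels of the classes of \<open>W\<close>: parts of \<open>A\<close> on the
    left, the colour towards \<open>A\<close> on the right.\<close>
  define q :: "'a \<Rightarrow> 'a + nat" where "q v = (if v \<in> A then Inl (p v) else Inr (c {v, a}))" for v
  have colW: "c {x, y} \<in> D" if "x \<in> W" "y \<in> W" "q x \<noteq> q y" for x y
  proof -
    have AS: "c {x, y} \<in> D" if "x \<in> A" "y \<in> W - A" for x y
    proof -
      have "y \<in> V - A" using that WV by blast
      then have "c {y, x} = c {y, a}" using A(1) a that(1) unfolding is_module_def by blast
      then show ?thesis using that by (auto simp: W_def S_def insert_commute)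
    qed
    consider "x \<in> A" "y \<in> A" | "x \<in> A" "y \<notin> A" | "x \<notin> A" "y \<in> A" | "x \<notin> A" "y \<notin> A" by blast
    then show ?thesis
    proof cases
      case 1
      then show ?thesis using pD D(1) that by (auto simp: q_def)
    next
      case 2
      then show ?thesis using AS that by blast
    next
      case 3
      then have "c {y, x} \<in> D" using AS that by blast
      then show ?thesis by (simp add: insert_commute)
    next
      case 4
      \<comment> \<open>Both vertices see \<open>a\<close> in different colours of \<open>D\<close>,
        so the triangle with \<open>a\<close> forces the third edge into \<open>D\<close>.\<close>
      have xy: "c {x, a} \<in> D" "c {y, a} \<in> D" "c {x, a} \<noteq> c {y, a}"
        using 4 that by (auto simp: q_def W_def S_def)
      then have "x \<noteq> y" by auto
      moreover have "x \<noteq> a" "y \<noteq> a" using 4 a by auto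
      moreover have "x \<in> V" "y \<in> V" "a \<in> V" using that WV a AV by auto
      ultimately have "c {x, y} = c {y, a} \<or> c {x, y} = c {x, a}"
        using rainbow_freeD[OF rf, of x y a] xy(3) by metis
      then show ?thesis using xy by auto
    qed
  qed
  have "card W \<le> (R - 1) * (l - 1)"
  proof (cases "\<forall>w\<in>W. card {v \<in> W. q v = q w} \<le> l - 1")
    case True
    \<comment> \<open>One vertex from each class.\<close>
    obtain T where T: "T \<subseteq> W" "q ` W = q ` T" "inj_on q T"
      using subset_image_inj[of "q ` W" q W] by blast
    have "colors T c \<subseteq> D"
    proof -
      have "c {x, y} \<in> D" if "x \<in> T" "y \<in> T" "x \<noteq> y" for x y
        using colW[of x y] that T(1) inj_onD[OF T(3), of x y] by blast
      then show ?thesis by (auto simp: colors_def)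
    qed
    moreover have "finite T" using T(1) finW finite_subset by blast
    moreover have "\<not> mono_bip l m T c" using no T(1) WV mono_bip_mono by blast
    ultimately have "card T < R"
      using mono_bip_of_two_colors[of T l m c D] D(3) unfolding R_def by fastforce
    then have "card (q ` W) \<le> R - 1" using T card_image by fastforce
    moreover have "card W \<le> card (q ` W) * (l - 1)"
      using True by (intro card_le_of_small_classes finW) blast
    ultimately show ?thesis by (meson le_trans mult_le_mono1)
  next
    case False
    then obtain b where b: "b \<in> W" and big: "l \<le> card {v \<in> W. q v = q b}" by fastforce
    \<comment> \<open>A class outside \<open>A\<close> lies in some \<open>S i\<close> and is too
      small.\<close>
    have bA: "b \<in> A"
    proof (rule ccontr)
      assume "b \<notin> A"
      then have "{v \<in> W. q v = q b} \<subseteq> S (c {b, a})" using WV by (auto simp: q_def S_def split: if_splits)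
      then have "card {v \<in> W. q v = q b} \<le> l - 1"
        by (rule le_trans[OF card_mono cardS, rotated]) (use V in \<open>simp add: S_def\<close>)
      then show False using big lm by linarith
    qed
    define B where "B = {v \<in> A. p v = p b}"
    have Beq: "{v \<in> W. q v = q b} = B" using bA by (auto simp: q_def W_def B_def split: if_splits)
    have modB: "is_module V c B" unfolding is_module_def
    proof (intro conjI ballI)
      show "B \<subseteq> V" using AV by (auto simp: B_def)
      fix v x y assume v: "v \<in> V - B" and xy: "x \<in> B" "y \<in> B"
      show "c {v, x} = c {v, y}"
      proof (cases "v \<in> A")
        case True
        then show ?thesis using pm[rule_format, of v v x y] v xy by (auto simp: B_def)
      next
        case False
        then show ?thesis using A(1) v xy by (auto simp: is_module_def B_def)
      qed
    qed
    have "B \<subset> A"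
    proof -
      obtain x y where "x \<in> A" "y \<in> A" "p x \<noteq> p y" using pne by blast
      then have "x \<notin> B \<or> y \<notin> B" by (auto simp: B_def)
      then show ?thesis using \<open>x \<in> A\<close> \<open>y \<in> A\<close> by (auto simp: B_def)
    qed
    then have "card B < card A" using AV(2) psubset_card_mono by blast
    then have Bm: "card B < m" using Amin[OF modB] by fastforce
    have bB: "b \<in> B" using bA by (simp add: B_def)
    have "l \<le> card B" using big Beq by simp
    note nb = card_module_neighbours(1)[OF V modB bB this no no']
    have m3: "m \<ge> 3" using Bm \<open>l \<le> card B\<close> lm by linarith
    have "W \<subseteq> B \<union> (\<Union>i\<in>D. {v \<in> V - B. c {v, b} = i})"
    proof
      fix w assume w: "w \<in> W"
      show "w \<in> B \<union> (\<Union>i\<in>D. {v \<in> V - B. c {v, b} = i})"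
      proof (cases "w \<in> B")
        case False
        then have "q w \<noteq> q b" using Beq w by blast
        then show ?thesis using colW[OF w b] w False WV by auto
      qed simp
    qed
    then have "card W \<le> card (B \<union> (\<Union>i\<in>D. {v \<in> V - B. c {v, b} = i}))"
      using V modB finite_subset finD by (intro card_mono) (auto simp: is_module_def)
    also have "\<dots> \<le> card B + card (\<Union>i\<in>D. {v \<in> V - B. c {v, b} = i})" by (rule card_Un_le)
    also have "card (\<Union>i\<in>D. {v \<in> V - B. c {v, b} = i}) \<le> (\<Sum>i\<in>D. card {v \<in> V - B. c {v, b} = i})"
      using finD by (intro card_UN_le)
    also have "\<dots> \<le> (\<Sum>i\<in>D. m - 1)" using nb by (intro sum_mono) auto
    also have "\<dots> = 2 * (m - 1)" using D(3) by simp
    finally have W3: "card W \<le> 3 * (m - 1)" using Bm by simp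
    \<comment> \<open>For \<open>l = 2\<close> the factor \<open>l - 1\<close> is 1, so
      \<open>R - 1\<close> itself must reach \<open>3 * (m - 1)\<close>; for larger \<open>l\<close>
      the factor is at least 2.\<close>
    show ?thesis
    proof (cases "l = 2")
      case True
      then show ?thesis using W3 ramsey_number_gt_triple[of l m] m3 unfolding R_def by simp
    next
      case False
      have "3 * (m - 1) \<le> 2 * (m - 1) * 2" by simp
      also have "\<dots> \<le> (R - 1) * (l - 1)"
        using False lm ramsey_number_gt_double[of l m] unfolding R_def by (intro mult_mono) auto
      finally show ?thesis using W3 by simp
    qed
  qed
  then show ?thesis using cardV by (simp add: add_mult_distrib)
qed

subsection \<open>The lower bound\<close>

text \<open>Both colours must occur, since the final colouring has to use all \<open>k\<close>. If
  the extremal colouring uses only one, then \<open>n < l + m\<close> and any colouring avoids a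
  copy, such as one with a single edge of colour 1.\<close>

lemma exists_extremal_two_coloring:
  assumes lm: "2 \<le> l" "l \<le> m"
  defines "n \<equiv> ramsey_number (complete_bipartite l m) - 1"
  shows "\<exists>c. colors {..<n} c = {0, 1} \<and> \<not> mono_bip l m {..<n} c"
proof -
  have n3: "n \<ge> 3" using ramsey_number_ge_order[of l m] lm unfolding n_def by linarith
  then have "n < ramsey_number (complete_bipartite l m)" unfolding n_def by linarith
  then obtain c where c: "colors {..<n} c \<subseteq> {0, 1}" "\<not> mono_bip l m {..<n} c"
    unfolding ramsey_number_complete_bipartite using not_less_Least by blast
  show ?thesis
  proof (cases "colors {..<n} c = {0, 1}")
    case True
    then show ?thesis using c by blast
  next
    case False
    then have "colors {..<n} c \<subseteq> {0} \<or> colors {..<n} c \<subseteq> {1}" using c(1) by blast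
    then have less: "n < l + m" using mono_bip_monochromatic[of "{..<n}" l m c] c(2) by fastforce
    define c' :: "nat set \<Rightarrow> nat" where "c' e = of_bool (e = {0, 1})" for e
    have "c' {0, 1} \<in> colors {..<n} c'" "c' {0, 2} \<in> colors {..<n} c'"
      using n3 by (intro colorsI; simp)+
    moreover have "c' {0, 1} = 1" "c' {0, 2} = 0" by (auto simp: c'_def doubleton_eq_iff)
    moreover have "colors {..<n} c' \<subseteq> {0, 1}" by (auto simp: colors_def c'_def)
    ultimately have "colors {..<n} c' = {0, 1}" by auto
    moreover have "\<not> mono_bip l m {..<n} c'" using mono_bip_card[of l m "{..<n}" c'] less by auto
    ultimately show ?thesis by blast
  qed
qed

text \<open>Each new colour is spent on \<open>l - 1\<close> new vertices, which cover all its edges, whereas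
  \<open>l\<close> vertices are needed to cover the edges of a complete bipartite graph.\<close>

lemma exists_rainbow_free_coloring:
  assumes lm: "2 \<le> l" "l \<le> m" and k: "2 \<le> k"
  defines "N \<equiv> ramsey_number (complete_bipartite l m) - 1 + (l - 1) * (k - 2)"
  shows "\<exists>c. colors {..<N} c = {..<k} \<and> rainbow_free {..<N} c \<and> \<not> mono_bip l m {..<N} c"
proof -
  define n where "n = ramsey_number (complete_bipartite l m) - 1"
  have n3: "n \<ge> 3" using ramsey_number_ge_order[of l m] lm unfolding n_def by linarith
  have N: "N = n + (l - 1) * (k - 2)" by (simp add: N_def n_def)
  obtain c0 where c0: "colors {..<n} c0 = {0, 1}" "\<not> mono_bip l m {..<n} c0"
    using exists_extremal_two_coloring[OF lm] unfolding n_def by blast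
  \<comment> \<open>New vertices come in groups of \<open>l - 1\<close>; the shift by 2 skips the
    colours of \<open>c0\<close>.\<close>
  define block where "block v = 2 + (v - n) div (l - 1)" for v
  define c where "c e = (if Max e < n then c0 e else block (Max e))" for e
  have c_lo: "c {x, y} = c0 {x, y}" if "x < n" "y < n" for x y using that by (simp add: c_def)
  have c_hi: "c {x, y} = block (max x y)" if "\<not> (x < n \<and> y < n)" for x y using that by (auto simp: c_def)
  have c0_lt: "c0 {x, y} < 2" if "x < n" "y < n" "x \<noteq> y" for x y
  proof -
    have "c0 {x, y} \<in> {0, 1}" unfolding c0(1)[symmetric] using that by (intro colorsI) auto
    then show ?thesis by auto
  qed
  have "colors {..<N} c \<subseteq> {..<k}"
  proof -
    have "c {x, y} < k" if "x < N" "y < N" "x \<noteq> y" for x y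
    proof (cases "x < n \<and> y < n")
      case True
      then show ?thesis using c_lo[of x y] c0_lt[of x y] that(3) k by simp
    next
      case False
      then have "max x y - n < (k - 2) * (l - 1)" using that N by (auto simp: max_def mult.commute)
      then have "(max x y - n) div (l - 1) < k - 2" by (rule less_mult_imp_div_less)
      then show ?thesis using c_hi[OF False] k unfolding block_def by linarith
    qed
    then show ?thesis by (auto simp: colors_def)
  qed
  moreover have "{..<k} \<subseteq> colors {..<N} c"
  proof
    fix i assume i: "i \<in> {..<k}"
    show "i \<in> colors {..<N} c"
    proof (cases "i < 2")
      case True
      then have "i \<in> colors {..<n} c0" unfolding c0(1) by auto
      then obtain x y where xy: "x < n" "y < n" "x \<noteq> y" "c0 {x, y} = i" by (auto simp: colors_def)
      then have "c {x, y} = i" using c_lo by simp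
      then show ?thesis using colorsI[of x "{..<N}" y c] xy N by auto
    next
      case False
      \<comment> \<open>The first vertex of the group with colour \<open>i\<close>.\<close>
      define v where "v = n + (i - 2) * (l - 1)"
      have "(i - 2) * (l - 1) < (k - 2) * (l - 1)" using i False lm by (intro mult_strict_right_mono) auto
      then have "v < N" by (simp add: v_def N mult.commute)
      moreover have "c {0, v} = i" using c_hi[of 0 v] False lm by (simp add: v_def block_def)
      ultimately show ?thesis using colorsI[of 0 "{..<N}" v c] n3 by (auto simp: v_def)
    qed
  qed
  moreover have "rainbow_free {..<N} c"
    unfolding rainbow_free_def
  proof (intro ballI impI)
    fix x y z :: nat assume ne: "x \<noteq> y" "y \<noteq> z" "x \<noteq> z"
    show "c {x, y} = c {y, z} \<or> c {y, z} = c {x, z} \<or> c {x, y} = c {x, z}"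
    proof (cases "x < n \<and> y < n \<and> z < n")
      case True
      then show ?thesis using c0_lt[of x y] c0_lt[of y z] c0_lt[of x z] ne by (simp add: c_lo) arith
    next
      case False
      \<comment> \<open>The largest vertex is new and gives its colour to both of its edges.\<close>
      then consider "z \<le> x" "y \<le> x" "\<not> x < n" | "z \<le> y" "x \<le> y" "\<not> y < n" | "x \<le> z" "y \<le> z" "\<not> z < n"
        by linarith
      then show ?thesis by cases (simp_all add: c_hi max_def)
    qed
  qed
  moreover have "\<not> mono_bip l m {..<N} c"
  proof
    assume "mono_bip l m {..<N} c"
    then obtain X Y i where XY: "X \<subseteq> {..<N}" "Y \<subseteq> {..<N}" "X \<inter> Y = {}" "card X = l" "card Y = m"
      and i [rule_format]: "\<forall>x\<in>X. \<forall>y\<in>Y. c {x, y} = i" by (rule mono_bipE)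
    have ne: "X \<noteq> {}" "Y \<noteq> {}" using XY(4,5) lm by auto
    show False
    proof (cases "\<forall>x\<in>X. \<forall>y\<in>Y. x < n \<and> y < n")
      case True
      then have "X \<subseteq> {..<n}" "Y \<subseteq> {..<n}" using ne by auto
      moreover have "c0 {x, y} = i" if "x \<in> X" "y \<in> Y" for x y
        using True i[OF that] c_lo[of x y] that by simp
      ultimately have "mono_bip l m {..<n} c0" using XY(3-5) by (intro mono_bipI[of X _ Y])
      then show False using c0 by simp
    next
      case False
      then obtain x0 y0 where "x0 \<in> X" "y0 \<in> Y" "\<not> (x0 < n \<and> y0 < n)" by blast
      then have "i = block (max x0 y0)" using i[of x0 y0] c_hi[of x0 y0] by simp
      then have i2: "2 \<le> i" by (simp add: block_def)
      let ?B = "{n + (i - 2) * (l - 1)..<n + (i - 1) * (l - 1)}"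
      have B: "v \<in> ?B" if "n \<le> v" "block v = i" for v
      proof -
        have d: "(v - n) div (l - 1) = i - 2" using that by (simp add: block_def)
        have "(i - 2) * (l - 1) \<le> v - n" using d div_times_less_eq_dividend by metis
        moreover have "v - n < (i - 1) * (l - 1)"
        proof -
          have "v - n < l - 1 + (v - n) div (l - 1) * (l - 1)"
            using lm by (intro dividend_less_div_times) simp
          also have "\<dots> = Suc (i - 2) * (l - 1)" unfolding d by simp
          also have "Suc (i - 2) = i - 1" using i2 by simp
          finally show ?thesis .
        qed
        ultimately show ?thesis using that(1) unfolding atLeastLessThan_iff by arith
      qed
      have cover: "x \<in> ?B \<or> y \<in> ?B" if "x \<in> X" "y \<in> Y" for x y
      proof -
        have "x \<noteq> y" using that XY(3) by auto
        then have hi: "\<not> (x < n \<and> y < n)"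
          using i[OF that] c_lo[of x y] c0_lt[of x y] i2 by auto
        then have "block (max x y) = i" "n \<le> max x y" using i[OF that] c_hi[OF hi] by auto
        then have "max x y \<in> ?B" using B by blast
        then show ?thesis by (simp only: max_def split: if_splits) simp_all
      qed
      have "i - 1 = Suc (i - 2)" using i2 by simp
      then have cardB: "card ?B = l - 1" by simp
      \<comment> \<open>Otherwise a vertex of \<open>X\<close> and one of \<open>Y\<close>, both
        outside the group, would contradict \<open>cover\<close>.\<close>
      have "X \<subseteq> ?B \<or> Y \<subseteq> ?B" using cover by blast
      then have "l \<le> card ?B" using XY(4,5) lm card_mono[of ?B X] card_mono[of ?B Y] by auto
      then show False using cardB lm by linarith
    qed
  qed
  ultimately show ?thesis by blast
qed

section \<open>Assembling both bounds\<close>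

text \<open>For \<open>l = 1\<close> the two bounds would be incompatible: the upper one is 1, the
  lower one is \<open>R\<close>, which is at least 2. Integers avoid truncated subtraction.\<close>

theorem theorem17:
  fixes l m k :: nat
  assumes "2 \<le> l" and "l \<le> m" and "2 \<le> k"
  defines "H \<equiv> complete_bipartite l m"
  defines "R \<equiv> int (ramsey_number H)"
  shows "R + (int l - 1) * (int k - 2) \<le> int (gallai_ramsey k H) \<and>
         int (gallai_ramsey k H) \<le> (R + int k - 3) * (int l - 1) + 1"
proof -
  let ?r = "ramsey_number H"
  \<comment> \<open>Quantifying over all larger orders makes \<open>P\<close> upward closed, so one
    bad colouring of order \<open>N\<close> refutes \<open>P n\<close> for all \<open>n\<close> up
    to \<open>N\<close>.\<close>
  define P where "P n \<longleftrightarrow> (\<forall>N\<ge>n. \<forall>c. colors {..<N} c = {..<k} \<longrightarrow>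
      \<not> rainbow_free {..<N} c \<or> mono_bip l m {..<N} c)" for n :: nat
  have gr: "gallai_ramsey k H = (LEAST n. P n)"
    unfolding gallai_ramsey_def P_def H_def has_rainbow_triangle_iff
      has_mono_copy_complete_bipartite_iff colors_complete_graph ..
  let ?u = "(?r - 1 + (k - 2)) * (l - 1) + 1"
  have Pu: "P ?u"
    unfolding P_def
  proof (intro allI impI)
    fix N c assume N: "?u \<le> N" and c: "colors {..<N} c = {..<k}"
    show "\<not> rainbow_free {..<N} c \<or> mono_bip l m {..<N} c"
      using card_rainbow_free_le[of "{..<N}" c "{..<k}" l m] c N assms(1-3) unfolding H_def by fastforce
  qed
  have r: "?r \<ge> 4" using ramsey_number_ge_order[of l m] assms(1,2) unfolding H_def by linarith
  have "gallai_ramsey k H \<le> ?u" unfolding gr using Pu by (rule Least_le)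
  then have "int (gallai_ramsey k H) \<le> int ?u" by (simp only: of_nat_le_iff)
  also have "int ?u = (R + int k - 3) * (int l - 1) + 1"
  proof -
    have "int (?r - 1 + (k - 2)) = R + int k - 3" "int (l - 1) = int l - 1"
      using r assms(1,3) by (simp_all add: R_def)
    then show ?thesis by (simp only: of_nat_add of_nat_mult of_nat_1)
  qed
  finally have upper: "int (gallai_ramsey k H) \<le> (R + int k - 3) * (int l - 1) + 1" .
  let ?N = "?r - 1 + (l - 1) * (k - 2)"
  obtain c where "colors {..<?N} c = {..<k}" "rainbow_free {..<?N} c" "\<not> mono_bip l m {..<?N} c"
    using exists_rainbow_free_coloring[OF assms(1-3)] unfolding H_def by blast
  then have "\<not> P n" if "n \<le> ?N" for n using that unfolding P_def by blast
  moreover have "P (gallai_ramsey k H)" unfolding gr using Pu by (rule LeastI)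
  ultimately have "?N < gallai_ramsey k H" by (meson not_le)
  then have "int ?N + 1 \<le> int (gallai_ramsey k H)" by linarith
  moreover have "int ?N + 1 = R + (int l - 1) * (int k - 2)"
    using r assms(1,3) by (simp add: R_def of_nat_diff)
  ultimately show ?thesis using upper by simp
qed

end
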